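(* Let $K$ be an algebraically closed field (of any characteristic). Let $n\ge 3$ and let $f,g$ be coprime positive integers such that $g<f$ and $(n-1)f\le ng$. Let $V\subset K^{2n}$ (with coordinates $x_1,\dots,x_n,y_1,\dots,y_n$) be the affine toric variety of codimension $n$ parametrized, for $(u_1,\dots,u_n)\in K^n$, by $$x_i=u_i^{fg}\ (1\le i\le n),\qquad y_i=u_i^{f-g}u_n^{f-g}\ (1\le i\le n-1),\qquad y_n=u_1^{g^2}\cdots u_{n-1}^{g^2}\,u_n^{g((n-1)g-(n-2)f)}.$$ Let $p$ and $q$ be two different primes, and let $F_1,\dots,F_{n-1},F_{n,p},F_{n,q}\in K[x_1,\dots,x_n,y_1,\dots,y_n]$ be the binomials defined in the context. Then $$V=V(F_1,\dots,F_{n-1},F_{n,p},F_{n,q}),$$ i.e. $V$ is exactly the set of common zeros in $K^{2n}$ of these $n+1$ binomials.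
   Context: $\mathbb{N}$ includes $0$. $V(G_1,\dots,G_m)$ denotes the set of common zeros in $K^{2n}$ of the polynomials $G_1,\dots,G_m$. For $i=1,\dots,n-1$, $$F_i=y_i^{fg}-x_i^{f-g}x_n^{f-g}.$$ For each prime $\ell$ (here $\ell=p$ or $\ell=q$), fix $\alpha,s,t\in\mathbb{N}$ (depending on $\ell$) with $\ell^{\alpha}=sf+tg$; such $\alpha,s,t$ exist because $f,g$ are coprime. Then $$F_{n,\ell}=y_n^{\ell^{\alpha}}-\Big(\prod_{i=1}^{n-1}x_i^{(s+2t)g-ft}\Big)\,x_n^{((n-1)s+nt)g-((n-2)s+(n-1)t)f}\,\prod_{i=1}^{n-1}y_i^{tg(f-g)}.$$ The conditions on $n,f,g$ imply $f<2g$ and $(n-2)f<(n-1)g$, so all exponents occurring are nonnegative integers. *)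

theory Defs
  imports
    "HOL-Library.FuncSet"
    "HOL-Library.Poly_Mapping"
    "HOL-Computational_Algebra.Computational_Algebra"
begin

datatype var = X nat | Y nat

text \<open>Multivariate polynomials as finitely supported maps from exponent vectors to coefficients;
  the ring structure is that of \<^theory>\<open>HOL-Library.Poly_Mapping\<close>.\<close>

type_synonym 'a mpol = "(var \<Rightarrow>\<^sub>0 nat) \<Rightarrow>\<^sub>0 'a"

definition indet :: "var \<Rightarrow> 'a::comm_ring_1 mpol" where
  "indet v = Poly_Mapping.single (Poly_Mapping.single v 1) 1"

abbreviation xvar :: "nat \<Rightarrow> 'a::comm_ring_1 mpol" where
  "xvar i \<equiv> indet (X i)"

abbreviation yvar :: "nat \<Rightarrow> 'a::comm_ring_1 mpol" where
  "yvar i \<equiv> indet (Y i)"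

definition mpol_eval :: "(var \<Rightarrow> 'a) \<Rightarrow> 'a::comm_ring_1 mpol \<Rightarrow> 'a" where
  "mpol_eval a P =
    (\<Sum>m\<in>Poly_Mapping.keys P. Poly_Mapping.lookup P m *
       (\<Prod>v\<in>Poly_Mapping.keys m. a v ^ Poly_Mapping.lookup m v))"

definition coords :: "nat \<Rightarrow> var set" where
  "coords n = X ` {1..n} \<union> Y ` {1..n}"

text \<open>The space $K^{2n}$: extensional functions on the $2n$ coordinates, so that points which agree
  in all coordinates are equal.\<close>

definition aff_space :: "nat \<Rightarrow> (var \<Rightarrow> 'a) set" where
  "aff_space n = (coords n \<rightarrow>\<^sub>E UNIV)"

definition zero_set :: "nat \<Rightarrow> 'a::comm_ring_1 mpol set \<Rightarrow> (var \<Rightarrow> 'a) set" where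
  "zero_set n S = {a \<in> aff_space n. \<forall>G\<in>S. mpol_eval a G = 0}"

text \<open>The exponents below use natural-number subtraction; by the following lemma it does not
  truncate.\<close>

lemma exponents_nonneg:
  fixes n f g s t :: nat
  assumes "n \<ge> 3" "g > 0" "(n - 1) * f \<le> n * g"
  shows "f < 2 * g"
    and "(n - 2) * f < (n - 1) * g"
    and "f * t \<le> (s + 2 * t) * g"
    and "((n - 2) * s + (n - 1) * t) * f \<le> ((n - 1) * s + n * t) * g"
proof -
  obtain k where n: "n = k + 3"
    using \<open>n \<ge> 3\<close> by (metis add.commute le_Suc_ex)
  have h: "(k + 2) * f \<le> (k + 3) * g"
    using assms(3) by (simp add: n)
  have "(k + 3) * g < (k + 2) * (2 * g)"
    using \<open>g > 0\<close> by (simp add: algebra_simps)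
  then have "(k + 2) * f < (k + 2) * (2 * g)"
    using h by linarith
  then show 1: "f < 2 * g"
    by (metis mult_less_cancel1)
  have "(k + 2) * ((k + 1) * f) \<le> (k + 1) * ((k + 3) * g)"
    using mult_le_mono2[OF h, of "k + 1"] by (metis mult.left_commute)
  also have "\<dots> < (k + 2) * ((k + 2) * g)"
    using \<open>g > 0\<close> by (simp add: algebra_simps)
  finally have "(k + 1) * f < (k + 2) * g"
    by (metis mult_less_cancel1)
  then show 2: "(n - 2) * f < (n - 1) * g"
    by (simp add: n)
  have "t * f \<le> t * (2 * g)"
    using 1 by simp
  then have "f * t \<le> t * (2 * g) + s * g"
    by (metis mult.commute trans_le_add1)
  then show "f * t \<le> (s + 2 * t) * g"
    by (simp add: algebra_simps)
  have "s * ((n - 2) * f) + t * ((n - 1) * f) \<le> s * ((n - 1) * g) + t * (n * g)"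
    using 2 assms(3) by (intro add_mono mult_le_mono2) auto
  then show "((n - 2) * s + (n - 1) * t) * f \<le> ((n - 1) * s + n * t) * g"
    by (simp only: add_mult_distrib add_mult_distrib2 mult.assoc mult.commute mult.left_commute)
qed

definition toric_point :: "nat \<Rightarrow> nat \<Rightarrow> nat \<Rightarrow> (nat \<Rightarrow> 'a::comm_ring_1) \<Rightarrow> var \<Rightarrow> 'a" where
  "toric_point n f g u = (\<lambda>v\<in>coords n. case v of
      X i \<Rightarrow> u i ^ (f * g)
    | Y i \<Rightarrow> if i < n then u i ^ (f - g) * u n ^ (f - g)
             else (\<Prod>j=1..n-1. u j ^ (g\<^sup>2)) * u n ^ (g * ((n - 1) * g - (n - 2) * f)))"

definition toric_variety :: "nat \<Rightarrow> nat \<Rightarrow> nat \<Rightarrow> (var \<Rightarrow> 'a::comm_ring_1) set" where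
  "toric_variety n f g = toric_point n f g ` ({1..n} \<rightarrow>\<^sub>E UNIV)"

definition F :: "nat \<Rightarrow> nat \<Rightarrow> nat \<Rightarrow> nat \<Rightarrow> 'a::comm_ring_1 mpol" where
  "F n f g i = yvar i ^ (f * g) - xvar i ^ (f - g) * xvar n ^ (f - g)"

text \<open>\<open>F_last n f g l \<alpha> s t\<close> is $F_{n,\ell}$ for $\ell = l$, built from a representation
  $\ell^\alpha = sf + tg$.\<close>

definition F_last ::
  "nat \<Rightarrow> nat \<Rightarrow> nat \<Rightarrow> nat \<Rightarrow> nat \<Rightarrow> nat \<Rightarrow> nat \<Rightarrow> 'a::comm_ring_1 mpol" where
  "F_last n f g l \<alpha> s t = yvar n ^ (l ^ \<alpha>)
     - (\<Prod>i=1..n-1. xvar i ^ ((s + 2 * t) * g - f * t))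
       * xvar n ^ (((n - 1) * s + n * t) * g - ((n - 2) * s + (n - 1) * t) * f)
       * (\<Prod>i=1..n-1. yvar i ^ (t * g * (f - g)))"

end

theory Submission
  imports Defs
begin

text \<open>Given a common zero with coordinates $x$, $y$, choose $f g$-th roots $u_i$ of the $x_i$. Because
  $f - g$ is coprime to $f g$, the equation $F_i = 0$ allows multiplying $u_i$ by a suitable
  $f g$-th root of unity so that $y_i = u_i^{f-g} u_n^{f-g}$ for $i < n$. For the points of this
  shape, $F_{n,\ell}$ takes the value $y_n^{\ell^\alpha} - T^{\ell^\alpha}$, where $T$ is the
  parametrized last coordinate. So $y_n$ and $T$ have the same $p^\alpha$-th and the same
  $q^\beta$-th powers, and these exponents are coprime, whence $y_n = T$.\<close>

subsection \<open>Evaluation of polynomials is a ring homomorphism\<close>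

definition monom_eval :: "(var \<Rightarrow> 'a::comm_ring_1) \<Rightarrow> (var \<Rightarrow>\<^sub>0 nat) \<Rightarrow> 'a" where
  "monom_eval a m = (\<Prod>v\<in>Poly_Mapping.keys m. a v ^ Poly_Mapping.lookup m v)"

text \<open>A variable outside \<open>keys m\<close> contributes an exponent 0, hence a factor 1.
  This brings several monomials to one common index set.\<close>

lemma monom_eval_superset:
  assumes "finite S" "Poly_Mapping.keys m \<subseteq> S"
  shows "monom_eval a m = (\<Prod>v\<in>S. a v ^ Poly_Mapping.lookup m v)"
  unfolding monom_eval_def
  by (rule prod.mono_neutral_left) (use assms in \<open>auto simp: in_keys_iff\<close>)

lemma monom_eval_add: "monom_eval a (m + m') = monom_eval a m * monom_eval a m'"
proof -
  let ?S = "Poly_Mapping.keys m \<union> Poly_Mapping.keys m'"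
  have "Poly_Mapping.keys (m + m') \<subseteq> ?S"
    by (rule keys_add)
  then show ?thesis
    by (simp add: monom_eval_superset[of ?S] lookup_add power_add prod.distrib)
qed

lemma mpol_eval_add: "mpol_eval a (P + Q) = mpol_eval a P + mpol_eval a Q"
  unfolding mpol_eval_def
  by (rule setsum_keys_plus_distrib) (auto simp: algebra_simps)

lemma mpol_eval_zero [simp]: "mpol_eval a 0 = 0"
  by (simp add: mpol_eval_def)

lemma mpol_eval_diff: "mpol_eval a (P - Q) = mpol_eval a P - mpol_eval a Q"
  using mpol_eval_add[of a "P - Q" Q] by simp

lemma mpol_eval_single: "mpol_eval a (Poly_Mapping.single m c) = c * monom_eval a m"
  by (simp add: mpol_eval_def monom_eval_def)

lemma mpol_eval_one [simp]: "mpol_eval a 1 = 1"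
  using mpol_eval_single[of a 0 1] by (simp add: monom_eval_def)

lemma mpol_eval_indet [simp]: "mpol_eval a (indet v) = a v"
  by (simp add: indet_def mpol_eval_single monom_eval_def)

text \<open>Updating at a key that is not yet present is the same as adding a single term, so the
  library induction can be phrased with ring operations.\<close>

lemma poly_mapping_add_induct [case_names zero single_add]:
  fixes P :: "('b \<Rightarrow>\<^sub>0 'c::monoid_add) \<Rightarrow> bool"
  assumes "P 0" and step: "\<And>k c h. P h \<Longrightarrow> P (Poly_Mapping.single k c + h)"
  shows "P h"
proof (induction h rule: Poly_Mapping.update_induct)
  case const
  show ?case by fact
next
  case (update h k c)
  have "Poly_Mapping.update k c h = Poly_Mapping.single k c + h"
    using update.hyps
    by (intro poly_mapping_eqI)
      (auto simp: lookup_update lookup_add lookup_single when_def in_keys_iff)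
  with step update.IH show ?case by metis
qed

text \<open>Both sides are additive in each factor; two nested inductions reduce the claim to a
  product of two single terms, where exponents add.\<close>

lemma mpol_eval_mult: "mpol_eval a (P * Q) = mpol_eval a P * mpol_eval a Q"
proof (induction P rule: poly_mapping_add_induct)
  case (single_add m c P)
  have "mpol_eval a (Poly_Mapping.single m c * Q) = c * monom_eval a m * mpol_eval a Q"
    by (induction Q rule: poly_mapping_add_induct)
      (simp_all add: distrib_left mpol_eval_add mult_single mpol_eval_single monom_eval_add
        algebra_simps)
  then show ?case
    using single_add by (simp add: distrib_right mpol_eval_add mpol_eval_single)
qed simp

lemma mpol_eval_power: "mpol_eval a (P ^ k) = mpol_eval a P ^ k"
  by (induction k) (simp_all add: mpol_eval_mult)

lemma mpol_eval_prod: "mpol_eval a (\<Prod>i\<in>I. P i) = (\<Prod>i\<in>I. mpol_eval a (P i))"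
  by (induction I rule: infinite_finite_induct) (simp_all add: mpol_eval_mult)

lemmas mpol_eval_simps = mpol_eval_diff mpol_eval_mult mpol_eval_power mpol_eval_prod

subsection \<open>Powers with coprime exponents\<close>

lemma eq_if_coprime_powers_eq:
  fixes a b :: "'a::field"
  assumes "coprime k l" "k > 0" "a ^ k = b ^ k" "a ^ l = b ^ l"
  shows "a = b"
proof (cases "a = 0")
  case True
  with assms(2,3) show ?thesis
    by (metis power_eq_0_iff zero_power)
next
  case False
  \<comment> \<open>This form of Bezout's identity keeps the exponents natural; the common factor
    \<open>a ^ (l * j)\<close> is cancelled at the end.\<close>
  obtain i j where ij: "k * i = l * j + 1"
    using bezout_nat[of k l] assms(1,2) by auto
  have "a ^ (l * j) * a = a ^ (k * i)"
    unfolding ij by simp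
  also have "\<dots> = b ^ (k * i)"
    by (simp add: power_mult assms(3))
  also have "\<dots> = a ^ (l * j) * b"
    unfolding ij by (simp add: power_mult assms(4))
  finally show ?thesis
    using False by simp
qed

text \<open>For nonzero \<open>v\<close> the quotient \<open>y / v ^ e\<close> is an
  \<open>N\<close>-th root of unity. Since \<open>e\<close> is invertible modulo \<open>N\<close>, a
  power of this quotient is an \<open>e\<close>-th root of it, and that power serves as
  \<open>z\<close>.\<close>

lemma root_of_power_eq:
  fixes v y :: "'a::field"
  assumes "coprime e N" "e > 0" "N > 0" "y ^ N = (v ^ e) ^ N"
  obtains z where "z ^ N = 1" "(z * v) ^ e = y"
proof (cases "v = 0")
  case True
  then have "y = 0"
    using assms by (simp add: power_0_left)
  with True assms(2) show thesis
    by (intro that[of 1]) auto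
next
  case False
  define w where "w = y / v ^ e"
  have w: "w ^ N = 1"
    using False assms(4) by (simp add: w_def power_divide)
  obtain i j where ij: "e * i = N * j + 1"
    using bezout_nat[of e N] assms(1,2) by auto
  have "(w ^ i) ^ N = (w ^ N) ^ i"
    by (metis mult.commute power_mult)
  then have "(w ^ i) ^ N = 1"
    by (simp add: w)
  moreover have "(w ^ i) ^ e = w ^ (N * j + 1)"
    unfolding ij[symmetric] by (metis mult.commute power_mult)
  then have "(w ^ i) ^ e = w"
    by (simp add: power_mult w)
  then have "(w ^ i * v) ^ e = y"
    using False by (simp add: power_mult_distrib w_def)
  ultimately show thesis
    using that by blast
qed

subsection \<open>The binomials on parametrized points\<close>

text \<open>This is the value called $T$ in the overview, named separately because it must be
  compared with a coordinate not yet known to equal it.\<close>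

definition last_coord :: "nat \<Rightarrow> nat \<Rightarrow> nat \<Rightarrow> (nat \<Rightarrow> 'a::comm_ring_1) \<Rightarrow> 'a" where
  "last_coord n f g u =
    (\<Prod>j=1..n-1. u j ^ (g\<^sup>2)) * u n ^ (g * ((n - 1) * g - (n - 2) * f))"

text \<open>Substituting the parametrization into the second monomial of \<open>F_last\<close> gives
  the left sides as exponents of \<open>u i\<close> for i < n and of \<open>u n\<close>. The right
  sides are the exponents in \<open>last_coord\<close> raised to the power
  \<open>s * f + t * g\<close>.\<close>

lemma F_last_exponents:
  fixes n f g s t :: nat
  assumes "n \<ge> 3" "g > 0" "g < f" "(n - 1) * f \<le> n * g"
  shows "f * g * ((s + 2 * t) * g - f * t) + (f - g) * (t * g * (f - g)) = g\<^sup>2 * (s * f + t * g)"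
    and "f * g * (((n - 1) * s + n * t) * g - ((n - 2) * s + (n - 1) * t) * f)
        + (n - 1) * ((f - g) * (t * g * (f - g)))
      = g * ((n - 1) * g - (n - 2) * f) * (s * f + t * g)"
proof -
  note nonneg = exponents_nonneg[OF assms(1,2,4)]
  \<comment> \<open>No subtraction truncates here, so both identities can be transferred to the
    integers and checked by expansion.\<close>
  have n: "int (n - 1) = int n - 1" "int (n - 2) = int n - 2"
    using assms(1) by auto
  have e: "int (f - g) = int f - int g"
    using assms(3) by simp
  have A: "int ((s + 2 * t) * g - f * t) = (int s + 2 * int t) * int g - int f * int t"
    using nonneg(3)[of t s] by (simp add: of_nat_diff)
  have B: "int (((n - 1) * s + n * t) * g - ((n - 2) * s + (n - 1) * t) * f)
      = ((int n - 1) * int s + int n * int t) * int g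
        - ((int n - 2) * int s + (int n - 1) * int t) * int f"
    using nonneg(4)[of s t] by (simp only: of_nat_diff of_nat_mult of_nat_add n)
  have C: "int ((n - 1) * g - (n - 2) * f) = (int n - 1) * int g - (int n - 2) * int f"
    using nonneg(2) by (simp only: of_nat_diff of_nat_mult n less_imp_le)
  have "int (f * g * ((s + 2 * t) * g - f * t) + (f - g) * (t * g * (f - g)))
      = int (g\<^sup>2 * (s * f + t * g))"
    by (simp only: of_nat_add[of "f * g * _"] of_nat_mult[of "f * g"] of_nat_mult[of "f - g"]
        of_nat_mult[of _ "f - g"] A e) (simp add: algebra_simps power2_eq_square)
  then show "f * g * ((s + 2 * t) * g - f * t) + (f - g) * (t * g * (f - g))
      = g\<^sup>2 * (s * f + t * g)"
    by (simp only: of_nat_eq_iff)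
  have "int (f * g * (((n - 1) * s + n * t) * g - ((n - 2) * s + (n - 1) * t) * f)
        + (n - 1) * ((f - g) * (t * g * (f - g))))
      = int (g * ((n - 1) * g - (n - 2) * f) * (s * f + t * g))"
    by (simp only: of_nat_add[of "f * g * _"] of_nat_mult[of "f * g"] of_nat_mult[of "f - g"]
        of_nat_mult[of "n - 1" "(f - g) * _"] of_nat_mult[of _ "f - g"] of_nat_mult[of g]
        of_nat_mult[of _ "s * f + t * g"] B C e n)
      (simp add: algebra_simps power2_eq_square)
  then show "f * g * (((n - 1) * s + n * t) * g - ((n - 2) * s + (n - 1) * t) * f)
        + (n - 1) * ((f - g) * (t * g * (f - g)))
      = g * ((n - 1) * g - (n - 2) * f) * (s * f + t * g)"
    by (simp only: of_nat_eq_iff)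
qed

text \<open>Nothing is assumed about \<open>a (Y n)\<close>, so the formula serves both inclusions:
  it gives vanishing on the variety, and an equation of powers at a common zero.\<close>

lemma mpol_eval_F_last:
  fixes n f g l \<alpha> s t :: nat and u :: "nat \<Rightarrow> 'a::comm_ring_1"
  assumes "n \<ge> 3" "g > 0" "g < f" "(n - 1) * f \<le> n * g"
    and l: "l ^ \<alpha> = s * f + t * g"
    and x: "\<And>i. i \<in> {1..n} \<Longrightarrow> a (X i) = u i ^ (f * g)"
    and y: "\<And>i. i \<in> {1..n-1} \<Longrightarrow> a (Y i) = u i ^ (f - g) * u n ^ (f - g)"
  shows "mpol_eval a (F_last n f g l \<alpha> s t) = a (Y n) ^ (l ^ \<alpha>) - last_coord n f g u ^ (l ^ \<alpha>)"
proof -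
  define A where "A = (s + 2 * t) * g - f * t"
  define B where "B = ((n - 1) * s + n * t) * g - ((n - 2) * s + (n - 1) * t) * f"
  define C where "C = (n - 1) * g - (n - 2) * f"
  define e where "e = f - g"
  note exps = F_last_exponents[OF assms(1-4), of s t, folded A_def B_def C_def e_def]
  have xn: "a (X n) = u n ^ (f * g)"
    using assms(1) x by simp
  have "(\<Prod>i=1..n-1. a (X i) ^ A) * a (X n) ^ B * (\<Prod>i=1..n-1. a (Y i) ^ (t * g * e))
      = (\<Prod>i=1..n-1. (u i ^ (f * g)) ^ A) * (u n ^ (f * g)) ^ B
        * (\<Prod>i=1..n-1. (u i ^ e * u n ^ e) ^ (t * g * e))"
    unfolding e_def xn using x y by (intro arg_cong2[of _ _ _ _ "(*)"] prod.cong) auto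
  \<comment> \<open>Each of the n - 1 factors coming from the \<open>Y i\<close> also contains a
    power of \<open>u n\<close>, whence the multiple n - 1 in its exponent.\<close>
  also have "\<dots> = (\<Prod>i=1..n-1. u i ^ (f * g * A + e * (t * g * e)))
        * u n ^ (f * g * B + (n - 1) * (e * (t * g * e)))"
    by (simp add: power_mult_distrib prod.distrib power_add
        flip: power_mult) (simp add: ac_simps)
  also have "\<dots> = ((\<Prod>i=1..n-1. u i ^ (g\<^sup>2)) * u n ^ (g * C)) ^ (s * f + t * g)"
    unfolding exps by (simp add: power_mult_distrib power_mult prod_power_distrib)
  finally show ?thesis
    unfolding F_last_def last_coord_def by (simp add: mpol_eval_simps l A_def B_def C_def e_def)
qed

section \<open>Points of the toric variety and the two inclusions\<close>

lemma toric_point_coords: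
  assumes "i \<in> {1..n}"
  shows "toric_point n f g u (X i) = u i ^ (f * g)"
    and "i < n \<Longrightarrow> toric_point n f g u (Y i) = u i ^ (f - g) * u n ^ (f - g)"
  using assms by (auto simp: toric_point_def coords_def)

lemma toric_point_last_coord:
  "n \<ge> 1 \<Longrightarrow> toric_point n f g u (Y n) = last_coord n f g u"
  by (simp add: toric_point_def coords_def last_coord_def)

lemma toric_point_in_aff_space: "toric_point n f g u \<in> aff_space n"
  by (simp add: toric_point_def aff_space_def)

lemma toric_point_eqI:
  assumes "a \<in> aff_space n"
    and "\<And>i. i \<in> {1..n} \<Longrightarrow> a (X i) = u i ^ (f * g)"
    and "\<And>i. i \<in> {1..n-1} \<Longrightarrow> a (Y i) = u i ^ (f - g) * u n ^ (f - g)"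
    and "a (Y n) = last_coord n f g u"
  shows "a = toric_point n f g u"
proof (rule PiE_ext)
  show "a \<in> coords n \<rightarrow>\<^sub>E UNIV" "toric_point n f g u \<in> coords n \<rightarrow>\<^sub>E UNIV"
    using assms(1) toric_point_in_aff_space[of n f g u] by (simp_all add: aff_space_def)
next
  fix v assume "v \<in> coords n"
  then consider i where "v = X i" "i \<in> {1..n}" | i where "v = Y i" "i \<in> {1..n}" "i < n"
    | "v = Y n" "n \<in> {1..n}"
    by (fastforce simp: coords_def)
  then show "a v = toric_point n f g u v"
    by cases (use assms(2-4) in \<open>simp_all add: toric_point_coords toric_point_last_coord\<close>)
qed

text \<open>Parameters in \<open>toric_variety\<close> are extensional on \<open>{1..n}\<close>;
  this allows the use of an arbitrary function \<open>u\<close>.\<close>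

lemma toric_point_restrict: "n \<ge> 1 \<Longrightarrow> toric_point n f g (restrict u {1..n}) = toric_point n f g u"
  by (rule toric_point_eqI[OF toric_point_in_aff_space])
    (auto simp: toric_point_coords toric_point_last_coord last_coord_def
      intro!: prod.cong arg_cong2[of _ _ _ _ "(*)"])

theorem theorem5:
  fixes n f g p q \<alpha>p sp tp \<alpha>q sq tq :: nat
  assumes "n \<ge> 3"
    and "f > 0" and "g > 0" and "coprime f g"
    and "g < f" and "(n - 1) * f \<le> n * g"
    and "prime p" and "prime q" and "p \<noteq> q"
    and "p ^ \<alpha>p = sp * f + tp * g"
    and "q ^ \<alpha>q = sq * f + tq * g"
  shows "(toric_variety n f g :: (var \<Rightarrow> 'a::alg_closed_field) set) =
    zero_set n (F n f g ` {1..n-1} \<union> {F_last n f g p \<alpha>p sp tp, F_last n f g q \<alpha>q sq tq})"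
    (is "_ = ?Z")
proof
  note eval_last = mpol_eval_F_last[OF assms(1,3,5,6)]
  show "(toric_variety n f g :: (var \<Rightarrow> 'a) set) \<subseteq> ?Z"
  proof
    fix a :: "var \<Rightarrow> 'a" assume "a \<in> toric_variety n f g"
    then obtain u where a: "a = toric_point n f g u"
      by (auto simp: toric_variety_def)
    have x: "a (X i) = u i ^ (f * g)" if "i \<in> {1..n}" for i
      using that by (simp add: a toric_point_coords)
    have y: "a (Y i) = u i ^ (f - g) * u n ^ (f - g)" if "i \<in> {1..n-1}" for i
      unfolding a by (rule toric_point_coords) (use that in auto)
    have yn: "a (Y n) = last_coord n f g u"
      unfolding a by (rule toric_point_last_coord) (use assms(1) in auto)
    have "mpol_eval a (F n f g i) = 0" if "i \<in> {1..n-1}" for i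
    proof -
      have "i \<in> {1..n}" "n \<in> {1..n}"
        using that by auto
      then show ?thesis
        using x y that
        by (simp add: F_def mpol_eval_simps power_mult_distrib flip: power_mult)
          (simp add: mult.commute)
    qed
    moreover have "mpol_eval a (F_last n f g p \<alpha>p sp tp) = 0"
      using eval_last[OF assms(10) x y] yn by simp
    moreover have "mpol_eval a (F_last n f g q \<alpha>q sq tq) = 0"
      using eval_last[OF assms(11) x y] yn by simp
    ultimately show "a \<in> ?Z"
      unfolding zero_set_def a using toric_point_in_aff_space by auto
  qed
  show "?Z \<subseteq> (toric_variety n f g :: (var \<Rightarrow> 'a) set)"
  proof
    fix a :: "var \<Rightarrow> 'a" assume "a \<in> ?Z"
    then have aff: "a \<in> aff_space n"
      and F0: "\<And>i. i \<in> {1..n-1} \<Longrightarrow> mpol_eval a (F n f g i) = 0"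
      and Fp: "mpol_eval a (F_last n f g p \<alpha>p sp tp) = 0"
      and Fq: "mpol_eval a (F_last n f g q \<alpha>q sq tq) = 0"
      by (auto simp: zero_set_def)
    have N: "f * g > 0"
      using assms(2,3) by simp
    then have "\<forall>i. \<exists>x. x ^ (f * g) = a (X i)"
      by (blast intro: nth_root_exists)
    then obtain r where r: "r i ^ (f * g) = a (X i)" for i
      by metis
    \<comment> \<open>A common divisor of \<open>f - g\<close> with either number divides the other
      one as well.\<close>
    have "coprime (f - g) g" "coprime (f - g) f"
      unfolding coprime_iff_gcd_eq_1
      using assms(4,5) gcd_diff1_nat[of g f] gcd_diff2_nat[of g f]
      by (simp_all add: gcd.commute)
    then have "coprime (f - g) (f * g)"
      by simp
    \<comment> \<open>The equation from \<open>F n f g i\<close> says that \<open>a (Y i)\<close>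
      and \<open>(r i * r n) ^ (f - g)\<close> have the same \<open>f * g\<close>-th power.\<close>
    then have "\<exists>z. z ^ (f * g) = 1 \<and> (z * (r i * r n)) ^ (f - g) = a (Y i)"
      if "i \<in> {1..n-1}" for i
    proof (rule root_of_power_eq)
      have "a (Y i) ^ (f * g) = a (X i) ^ (f - g) * a (X n) ^ (f - g)"
        using F0[OF that] by (simp add: F_def mpol_eval_simps)
      then show "a (Y i) ^ (f * g) = ((r i * r n) ^ (f - g)) ^ (f * g)"
        by (simp add: power_mult_distrib mult.commute flip: r power_mult)
    qed (use assms(5) N in auto)
    then obtain z where z: "\<And>i. i \<in> {1..n-1} \<Longrightarrow>
        z i ^ (f * g) = 1 \<and> (z i * (r i * r n)) ^ (f - g) = a (Y i)"
      by metis
    \<comment> \<open>The root of unity is absorbed into \<open>u i\<close> alone. As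
      \<open>u n\<close> stays \<open>r n\<close>, the corrections for different i do not
      interfere.\<close>
    define u where "u i = (if i < n then z i * r i else r n)" for i
    have x: "a (X i) = u i ^ (f * g)" if "i \<in> {1..n}" for i
    proof (cases "i = n")
      case False
      then have "i \<in> {1..n-1}" "i < n"
        using that by auto
      then show ?thesis
        using z r by (simp add: u_def power_mult_distrib)
    qed (simp add: u_def r)
    have y: "a (Y i) = u i ^ (f - g) * u n ^ (f - g)" if "i \<in> {1..n-1}" for i
    proof -
      have "i < n"
        using that by auto
      then show ?thesis
        using z[OF that] by (simp add: u_def mult.assoc flip: power_mult_distrib)
    qed
    \<comment> \<open>Two different primes give coprime exponents, so the two equations of powers
      together determine \<open>a (Y n)\<close>.\<close>
    have "coprime (p ^ \<alpha>p) (q ^ \<alpha>q)"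
      using assms(7-9) by (simp add: primes_coprime)
    moreover have "p ^ \<alpha>p > 0"
      using assms(7) by (simp add: prime_gt_0_nat)
    ultimately have "a (Y n) = last_coord n f g u"
      by (rule eq_if_coprime_powers_eq)
        (use Fp Fq eval_last[OF assms(10) x y] eval_last[OF assms(11) x y] in simp_all)
    then have "a = toric_point n f g (restrict u {1..n})"
      using toric_point_eqI[OF aff x y] toric_point_restrict[of n f g u] assms(1) by simp
    then show "a \<in> toric_variety n f g"
      unfolding toric_variety_def by auto
  qed
qed

end
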